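(* Let $\alpha>-1$ and let $n$ be a positive integer. Let $a,b\in\mathbb{C}\setminus\{0\}$ and $c\in\mathbb{D}$, and let $$\psi(z)=\frac{az^n}{n!\,(1-\overline{c}z)^{n+\alpha+2}},\qquad \varphi(z)=c+\frac{bz}{1-\overline{c}z}\qquad(z\in\mathbb{D})$$ (so $a=\psi^{(n)}(0)$, $b=\varphi'(0)$, $c=\varphi(0)$), where $\varphi$ maps $\mathbb{D}$ into itself and $D_{\psi,\varphi,n}$ is bounded on $A_\alpha^2$. Then $D_{\psi,\varphi,n}$ is normal on $A_\alpha^2$ if and only if $b\in\mathbb{R}\setminus\{0\}$ or $c=0$. Moreover, if $D_{\psi,\varphi,n}$ is normal, then: (i) if $c=0$, then $D_{\psi,\varphi,n}$ is $J$-symmetric; (ii) if $c\neq0$, then $D_{\psi,\varphi,n}$ is $C_{e^{-2i\theta}z}J$-symmetric, where $\theta=\mathrm{Arg}(c)$.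
   Context: $\mathbb{D}$ is the open unit disk in $\mathbb{C}$. For $\alpha>-1$, the weighted Bergman space $A_\alpha^2$ is the Hilbert space of analytic functions $f(z)=\sum_{j\ge0}a_jz^j$ on $\mathbb{D}$ with $\|f\|^2=\sum_{j\ge0}|a_j|^2\beta(j)^2<\infty$, where $\beta(j)^2=\frac{j!\,\Gamma(\alpha+2)}{\Gamma(j+\alpha+2)}$, with inner product $\langle\sum a_jz^j,\sum b_jz^j\rangle=\sum a_j\overline{b_j}\beta(j)^2$. Non-integer powers use the principal branch. The weighted composition--differentiation operator of order $n$ is $D_{\psi,\varphi,n}f=\psi\cdot(f^{(n)}\circ\varphi)$. For $|\lambda|=1$, $C_{\lambda z}$ is the composition operator $(C_{\lambda z}f)(z)=f(\lambda z)$. A conjugation on a complex Hilbert space is an antilinear isometric involution $C$; a bounded operator $T$ is $C$-symmetric if $CT^*C=T$. $J$ is the conjugation $(Jf)(z)=\overline{f(\overline{z})}$; $C_{\lambda z}J$ is also a conjugation for $|\lambda|=1$. $\mathrm{Arg}(c)\in[0,2\pi)$ is the argument of $c$, so $c=|c|e^{i\,\mathrm{Arg}(c)}$. *)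

theory Defs
  imports "HOL-Complex_Analysis.Complex_Analysis"
begin

abbreviation unit_disk :: "complex set" where
  "unit_disk \<equiv> ball 0 1"

definition taylor_coeff :: "(complex \<Rightarrow> complex) \<Rightarrow> nat \<Rightarrow> complex" where
  "taylor_coeff f j = (deriv ^^ j) f 0 / fact j"

text \<open>The squared weight \<open>\<beta>(j)\<^sup>2\<close>.\<close>

definition bergman_weight :: "real \<Rightarrow> nat \<Rightarrow> real" where
  "bergman_weight \<alpha> j = fact j * Gamma (\<alpha> + 2) / Gamma (real j + \<alpha> + 2)"

text \<open>Functions on the disk are represented by total functions that vanish outside it, so that
  equality of elements of the space is HOL equality.\<close>

definition bergman_space :: "real \<Rightarrow> (complex \<Rightarrow> complex) set" where
  "bergman_space \<alpha> = {f. f holomorphic_on unit_disk \<and> (\<forall>z. z \<notin> unit_disk \<longrightarrow> f z = 0) \<and>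
     summable (\<lambda>j. (cmod (taylor_coeff f j))\<^sup>2 * bergman_weight \<alpha> j)}"

definition bergman_inner :: "real \<Rightarrow> (complex \<Rightarrow> complex) \<Rightarrow> (complex \<Rightarrow> complex) \<Rightarrow> complex" where
  "bergman_inner \<alpha> f g =
     (\<Sum>j. taylor_coeff f j * cnj (taylor_coeff g j) * of_real (bergman_weight \<alpha> j))"

definition bergman_norm :: "real \<Rightarrow> (complex \<Rightarrow> complex) \<Rightarrow> real" where
  "bergman_norm \<alpha> f = sqrt (\<Sum>j. (cmod (taylor_coeff f j))\<^sup>2 * bergman_weight \<alpha> j)"

type_synonym fun_op = "(complex \<Rightarrow> complex) \<Rightarrow> (complex \<Rightarrow> complex)"

definition bounded_op :: "real \<Rightarrow> fun_op \<Rightarrow> bool" where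
  "bounded_op \<alpha> T \<longleftrightarrow>
     (\<forall>f\<in>bergman_space \<alpha>. T f \<in> bergman_space \<alpha>) \<and>
     (\<forall>f\<in>bergman_space \<alpha>. \<forall>g\<in>bergman_space \<alpha>. T (\<lambda>z. f z + g z) = (\<lambda>z. T f z + T g z)) \<and>
     (\<forall>k. \<forall>f\<in>bergman_space \<alpha>. T (\<lambda>z. k * f z) = (\<lambda>z. k * T f z)) \<and>
     (\<exists>K. \<forall>f\<in>bergman_space \<alpha>. bergman_norm \<alpha> (T f) \<le> K * bergman_norm \<alpha> f)"

text \<open>For bounded \<open>T\<close> and \<open>g\<close> in the space, the description is proper by the Riesz
  representation theorem; the value is meaningless otherwise.\<close>

definition hadjoint :: "real \<Rightarrow> fun_op \<Rightarrow> fun_op" where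
  "hadjoint \<alpha> T g = (THE h. h \<in> bergman_space \<alpha> \<and>
     (\<forall>f\<in>bergman_space \<alpha>. bergman_inner \<alpha> (T f) g = bergman_inner \<alpha> f h))"

definition normal_op :: "real \<Rightarrow> fun_op \<Rightarrow> bool" where
  "normal_op \<alpha> T \<longleftrightarrow> bounded_op \<alpha> T \<and>
     (\<forall>f\<in>bergman_space \<alpha>. T (hadjoint \<alpha> T f) = hadjoint \<alpha> T (T f))"

definition conjugation :: "real \<Rightarrow> fun_op \<Rightarrow> bool" where
  "conjugation \<alpha> C \<longleftrightarrow>
     (\<forall>f\<in>bergman_space \<alpha>. C f \<in> bergman_space \<alpha>) \<and>
     (\<forall>f\<in>bergman_space \<alpha>. \<forall>g\<in>bergman_space \<alpha>. C (\<lambda>z. f z + g z) = (\<lambda>z. C f z + C g z)) \<and>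
     (\<forall>k. \<forall>f\<in>bergman_space \<alpha>. C (\<lambda>z. k * f z) = (\<lambda>z. cnj k * C f z)) \<and>
     (\<forall>f\<in>bergman_space \<alpha>. bergman_norm \<alpha> (C f) = bergman_norm \<alpha> f) \<and>
     (\<forall>f\<in>bergman_space \<alpha>. C (C f) = f)"

definition C_symmetric :: "real \<Rightarrow> fun_op \<Rightarrow> fun_op \<Rightarrow> bool" where
  "C_symmetric \<alpha> C T \<longleftrightarrow> conjugation \<alpha> C \<and> bounded_op \<alpha> T \<and>
     (\<forall>f\<in>bergman_space \<alpha>. C (hadjoint \<alpha> T (C f)) = T f)"

definition conj_J :: fun_op where
  "conj_J f = (\<lambda>z. cnj (f (cnj z)))"

definition rotation_op :: "complex \<Rightarrow> fun_op" where
  "rotation_op l f = (\<lambda>z. f (l * z))"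

definition comp_diff_op :: "(complex \<Rightarrow> complex) \<Rightarrow> (complex \<Rightarrow> complex) \<Rightarrow> nat \<Rightarrow> fun_op" where
  "comp_diff_op \<psi> \<phi> n f = (\<lambda>z. if z \<in> unit_disk then \<psi> z * (deriv ^^ n) f (\<phi> z) else 0)"

end

theory Submission
  imports Defs
begin

text \<open>
  With respect to the monomials, \<open>T = D\<^bsub>\<psi>,\<phi>,n\<^esub>\<close> has the matrix
  \<open>\<langle>T z\<^sup>j, z\<^sup>k\<rangle> = a N\<^sub>b(j,k)\<close>, where
  \<open>N\<^sub>b(j,k) = \<Sum>\<^sub>l b\<^bsup>l-n\<^esup> c\<^bsup>j-l\<^esup> cnj(c)\<^bsup>k-l\<^esup> d(l,j,k)\<close>
  with positive coefficients \<open>d\<close> symmetric in \<open>j\<close> and \<open>k\<close>; this follows from the binomial series of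
  \<open>(1 - cnj(c) z)\<^bsup>-(l+\<alpha>+2)\<^esup>\<close>. Transposing exchanges \<open>c\<close> and its conjugate, which
  conjugation by \<open>C = C\<^bsub>\<lambda>z\<^esub> J\<close> undoes when \<open>\<lambda> c = cnj(c)\<close>, so \<open>T\<^sup>* = C T C\<close> whether or not
  \<open>T\<close> is normal. If \<open>b\<close> is real, then \<open>T\<^sup>* = (cnj(a)/a) T\<close>; if \<open>c = 0\<close>, then \<open>T\<close> is diagonal; in both
  cases \<open>T\<close> is normal. Conversely, for normal \<open>T\<close> we have
  \<open>\<langle>T z\<^sup>n, T z\<^bsup>n+1\<^esup>\<rangle> = \<langle>T\<^sup>* z\<^sup>n, T\<^sup>* z\<^bsup>n+1\<^esup>\<rangle>\<close>, and the difference of the two sides is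
  \<open>\<bar>a\<bar>\<^sup>2 (cnj(b) - b) cnj(c)\<close> times a series of nonnegative terms that are not all zero.
\<close>

section \<open>Taylor coefficients and power series on the unit disk\<close>

text \<open>Uniqueness of power series expansions. Coefficients are read off from convergent series,
  so that no derivative at 0 has to be computed.\<close>

lemma taylor_coeff_eqI:
  assumes "\<And>z. z \<in> unit_disk \<Longrightarrow> (\<lambda>k. u k * z ^ k) sums f z"
  shows "taylor_coeff f k = u k"
proof -
  have "eventually (\<lambda>z. z \<in> unit_disk) (nhds (0::complex))"
    by (intro eventually_nhds_in_open) auto
  then have "eventually (\<lambda>z. (\<lambda>k. fps_nth (Abs_fps u) k * z ^ k) sums f z) (nhds 0)"
    by (rule eventually_mono) (simp add: assms)
  then have "f has_fps_expansion Abs_fps u"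
    by (rule has_fps_expansionI)
  from fps_nth_fps_expansion[OF this, of k] show ?thesis
    by (simp add: taylor_coeff_def)
qed

lemma holomorphic_unit_disk_sums:
  assumes "f holomorphic_on unit_disk" "z \<in> unit_disk"
  shows "(\<lambda>k. taylor_coeff f k * z ^ k) sums f z"
  using holomorphic_power_series[OF assms] by (simp add: taylor_coeff_def)

lemma sums_imp_holomorphic_unit_disk:
  assumes "\<And>z. z \<in> unit_disk \<Longrightarrow> (\<lambda>k. u k * z ^ k) sums f z"
  shows "f holomorphic_on unit_disk"
  by (rule power_series_holomorphic[where a = u]) (use assms in simp)

text \<open>The cut-off follows the convention that members of the space vanish outside the
  disk.\<close>

definition disk_monomial :: "nat \<Rightarrow> complex \<Rightarrow> complex" where
  "disk_monomial j z = (if z \<in> unit_disk then z ^ j else 0)"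

lemma disk_monomial_sums:
  assumes "z \<in> unit_disk"
  shows "(\<lambda>k. (if k = j then 1 else 0) * z ^ k) sums disk_monomial j z"
proof -
  have "(\<lambda>k. if k = j then z ^ k else 0) sums z ^ j"
    by (rule sums_single)
  moreover have "(\<lambda>k. if k = j then z ^ k else 0) = (\<lambda>k. (if k = j then 1 else 0) * z ^ k)"
    by auto
  ultimately show ?thesis
    using assms by (simp add: disk_monomial_def)
qed

lemma taylor_coeff_disk_monomial: "taylor_coeff (disk_monomial j) k = (if k = j then 1 else 0)"
  by (rule taylor_coeff_eqI) (rule disk_monomial_sums)

lemma disk_monomial_holomorphic: "disk_monomial j holomorphic_on unit_disk"
  by (rule sums_imp_holomorphic_unit_disk) (rule disk_monomial_sums)

lemma taylor_coeff_add:
  assumes "f holomorphic_on unit_disk" "g holomorphic_on unit_disk"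
  shows "taylor_coeff (\<lambda>z. f z + g z) k = taylor_coeff f k + taylor_coeff g k"
proof (rule taylor_coeff_eqI)
  fix z :: complex assume "z \<in> unit_disk"
  from sums_add[OF assms[THEN holomorphic_unit_disk_sums, OF this]]
  show "(\<lambda>k. (taylor_coeff f k + taylor_coeff g k) * z ^ k) sums (f z + g z)"
    by (simp add: algebra_simps)
qed

lemma taylor_coeff_cmult:
  assumes "f holomorphic_on unit_disk"
  shows "taylor_coeff (\<lambda>z. c * f z) k = c * taylor_coeff f k"
proof (rule taylor_coeff_eqI)
  fix z :: complex assume "z \<in> unit_disk"
  from sums_mult[OF holomorphic_unit_disk_sums[OF assms this], of c]
  show "(\<lambda>k. c * taylor_coeff f k * z ^ k) sums (c * f z)"
    by (simp add: mult.assoc)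
qed

section \<open>The weighted Bergman space and its inner product\<close>

locale weighted_bergman =
  fixes \<alpha> :: real
  assumes alpha: "\<alpha> > - 1"
begin

abbreviation "H \<equiv> bergman_space \<alpha>"
abbreviation "wt \<equiv> bergman_weight \<alpha>"
abbreviation "ip \<equiv> bergman_inner \<alpha>"
abbreviation "nrm \<equiv> bergman_norm \<alpha>"

lemma pochhammer_alpha_pos: "pochhammer (\<alpha> + 2) k > 0"
  using alpha by (intro pochhammer_pos) simp

text \<open>The Pochhammer form is used because the coefficients of the binomial series are
  Pochhammer symbols too, so that the two cancel in the matrix of the operator.\<close>

lemma weight_eq: "wt k = fact k / pochhammer (\<alpha> + 2) k"
proof -
  have "\<alpha> + 2 \<notin> \<int>\<^sub>\<le>\<^sub>0"
    using alpha nonpos_Ints_nonpos[of "\<alpha> + 2"] by auto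
  then show ?thesis
    using alpha by (simp add: pochhammer_Gamma bergman_weight_def add_ac)
qed

lemma weight_pos: "wt k > 0"
  using pochhammer_alpha_pos by (simp add: weight_eq)

lemma weight_nonneg: "wt k \<ge> 0"
  using weight_pos less_imp_le by blast

lemma H_holomorphic: "f \<in> H \<Longrightarrow> f holomorphic_on unit_disk"
  and H_outside: "f \<in> H \<Longrightarrow> z \<notin> unit_disk \<Longrightarrow> f z = 0"
  and H_summable: "f \<in> H \<Longrightarrow> summable (\<lambda>j. (cmod (taylor_coeff f j))\<^sup>2 * wt j)"
  by (auto simp: bergman_space_def)

lemma H_I:
  assumes "\<And>z. z \<in> unit_disk \<Longrightarrow> (\<lambda>k. u k * z ^ k) sums f z"
    and "\<And>z. z \<notin> unit_disk \<Longrightarrow> f z = 0" and "summable (\<lambda>j. (cmod (u j))\<^sup>2 * wt j)"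
  shows "f \<in> H"
proof -
  have "taylor_coeff f = u"
    using taylor_coeff_eqI[of u f] assms(1) by blast
  then show ?thesis
    using assms sums_imp_holomorphic_unit_disk[of u f] by (simp add: bergman_space_def)
qed

text \<open>Inside the disk both functions are sums of the same series, and outside it both are 0.
  Operator identities can therefore be checked coefficientwise.\<close>

lemma H_eqI:
  assumes "f \<in> H" "g \<in> H" "\<And>k. taylor_coeff f k = taylor_coeff g k"
  shows "f = g"
proof
  fix z
  show "f z = g z"
  proof (cases "z \<in> unit_disk")
    case True
    have "(\<lambda>k. taylor_coeff g k * z ^ k) sums f z"
      using holomorphic_unit_disk_sums[OF H_holomorphic[OF assms(1)] True] assms(3) by simp
    then show ?thesis
      using holomorphic_unit_disk_sums[OF H_holomorphic[OF assms(2)] True] by (rule sums_unique2)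
  qed (simp add: H_outside[OF assms(1)] H_outside[OF assms(2)])
qed

lemma H_disk_monomial: "disk_monomial j \<in> H"
proof -
  have "summable (\<lambda>k. (cmod (taylor_coeff (disk_monomial j) k))\<^sup>2 * wt k)"
    by (rule summable_finite[of "{j}"]) (auto simp: taylor_coeff_disk_monomial)
  then show ?thesis
    by (simp add: bergman_space_def disk_monomial_holomorphic) (simp add: disk_monomial_def)
qed

lemma H_cmult: "f \<in> H \<Longrightarrow> (\<lambda>z. c * f z) \<in> H"
  unfolding bergman_space_def
  by (auto intro!: holomorphic_intros summable_mult
      simp: taylor_coeff_cmult norm_mult power_mult_distrib mult.assoc)

text \<open>Square summability rests on \<open>(x + y)^2 <= 2 x^2 + 2 y^2\<close> for the moduli,
  which restates \<open>(x - y)^2 >= 0\<close>.\<close>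

lemma H_add:
  assumes "f \<in> H" "g \<in> H"
  shows "(\<lambda>z. f z + g z) \<in> H"
proof -
  have "summable (\<lambda>j. (cmod (taylor_coeff f j + taylor_coeff g j))\<^sup>2 * wt j)"
  proof (rule summable_comparison_test')
    show "summable (\<lambda>j. 2 * ((cmod (taylor_coeff f j))\<^sup>2 * wt j)
        + 2 * ((cmod (taylor_coeff g j))\<^sup>2 * wt j))"
      by (intro summable_add summable_mult H_summable assms)
    fix j
    have "(cmod (taylor_coeff f j + taylor_coeff g j))\<^sup>2
        \<le> (cmod (taylor_coeff f j) + cmod (taylor_coeff g j))\<^sup>2"
      by (intro power_mono norm_triangle_ineq) auto
    also have "\<dots> \<le> 2 * (cmod (taylor_coeff f j))\<^sup>2 + 2 * (cmod (taylor_coeff g j))\<^sup>2"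
      using zero_le_power2[of "cmod (taylor_coeff f j) - cmod (taylor_coeff g j)"]
      by (simp add: power2_eq_square algebra_simps)
    finally show "norm ((cmod (taylor_coeff f j + taylor_coeff g j))\<^sup>2 * wt j)
      \<le> 2 * ((cmod (taylor_coeff f j))\<^sup>2 * wt j) + 2 * ((cmod (taylor_coeff g j))\<^sup>2 * wt j)"
      using mult_right_mono[OF _ weight_nonneg[of j]] weight_nonneg[of j]
      by (fastforce simp: algebra_simps)
  qed
  then show ?thesis
    using assms by (auto simp: bergman_space_def taylor_coeff_add intro!: holomorphic_intros)
qed

lemma H_zero: "(\<lambda>z. 0) \<in> H"
  using H_cmult[OF H_disk_monomial[of 0], of 0] by simp

lemma H_sum: "(\<And>j. j \<in> A \<Longrightarrow> f j \<in> H) \<Longrightarrow> (\<lambda>z. \<Sum>j\<in>A. f j z) \<in> H"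
  by (induction A rule: infinite_finite_induct) (auto simp: H_zero H_add)

lemma taylor_coeff_sum:
  "(\<And>j. j \<in> A \<Longrightarrow> f j \<in> H) \<Longrightarrow> taylor_coeff (\<lambda>z. \<Sum>j\<in>A. f j z) k = (\<Sum>j\<in>A. taylor_coeff (f j) k)"
proof (induction A rule: infinite_finite_induct)
  case (insert x F)
  then show ?case
    by (simp add: taylor_coeff_add H_holomorphic H_sum)
qed (use taylor_coeff_cmult[OF disk_monomial_holomorphic[of 0], of 0] in simp_all)

lemma norm_nonneg: "f \<in> H \<Longrightarrow> nrm f \<ge> 0"
  and norm_square: "f \<in> H \<Longrightarrow> (nrm f)\<^sup>2 = (\<Sum>j. (cmod (taylor_coeff f j))\<^sup>2 * wt j)"
  using weight_nonneg by (simp_all add: bergman_norm_def suminf_nonneg H_summable)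

text \<open>Cauchy-Schwarz for finite sums, applied to moduli scaled by the square roots of the
  weights. The bound is uniform in \<open>N\<close>, so it gives both absolute convergence of the
  inner product series and the Cauchy-Schwarz inequality.\<close>

lemma inner_partial_sum_le:
  assumes "f \<in> H" "g \<in> H"
  shows "(\<Sum>j<N. cmod (taylor_coeff f j * cnj (taylor_coeff g j) * of_real (wt j)))
    \<le> nrm f * nrm g"
proof -
  define u where "u j = cmod (taylor_coeff f j) * sqrt (wt j)" for j
  define v where "v j = cmod (taylor_coeff g j) * sqrt (wt j)" for j
  have u2: "(u j)\<^sup>2 = (cmod (taylor_coeff f j))\<^sup>2 * wt j"
    and v2: "(v j)\<^sup>2 = (cmod (taylor_coeff g j))\<^sup>2 * wt j" for j
    using weight_nonneg by (simp_all add: u_def v_def power_mult_distrib)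
  have uv: "cmod (taylor_coeff f j * cnj (taylor_coeff g j) * of_real (wt j)) = u j * v j" for j
    using weight_nonneg[of j] by (simp add: u_def v_def norm_mult)
  have le_nrm: "(\<Sum>j<N. (u j)\<^sup>2) \<le> (nrm f)\<^sup>2" "(\<Sum>j<N. (v j)\<^sup>2) \<le> (nrm g)\<^sup>2"
    unfolding u2 v2 norm_square[OF assms(1)] norm_square[OF assms(2)]
    by (intro sum_le_suminf H_summable assms; simp add: weight_nonneg)+
  have "(\<Sum>j<N. u j * v j)\<^sup>2 \<le> (\<Sum>j<N. (u j)\<^sup>2) * (\<Sum>j<N. (v j)\<^sup>2)"
    by (rule Cauchy_Schwarz_ineq_sum)
  also have "\<dots> \<le> (nrm f * nrm g)\<^sup>2"
    unfolding power_mult_distrib using le_nrm by (intro mult_mono sum_nonneg) auto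
  finally have "(\<Sum>j<N. u j * v j) \<le> nrm f * nrm g"
    by (rule power2_le_imp_le) (simp add: norm_nonneg assms)
  then show ?thesis
    by (simp add: uv)
qed

lemma inner_summable_norm:
  assumes "f \<in> H" "g \<in> H"
  shows "summable (\<lambda>j. cmod (taylor_coeff f j * cnj (taylor_coeff g j) * of_real (wt j)))"
  by (rule summableI_nonneg_bounded[OF _ inner_partial_sum_le[OF assms]]) simp

lemma inner_sums:
  assumes "f \<in> H" "g \<in> H"
  shows "(\<lambda>j. taylor_coeff f j * cnj (taylor_coeff g j) * of_real (wt j)) sums ip f g"
  unfolding bergman_inner_def
  by (rule summable_sums[OF summable_norm_cancel[OF inner_summable_norm[OF assms]]])

lemma inner_Cauchy_Schwarz:
  assumes "f \<in> H" "g \<in> H"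
  shows "cmod (ip f g) \<le> nrm f * nrm g"
proof -
  have "cmod (ip f g)
      \<le> (\<Sum>j. cmod (taylor_coeff f j * cnj (taylor_coeff g j) * of_real (wt j)))"
    unfolding bergman_inner_def by (rule summable_norm[OF inner_summable_norm[OF assms]])
  also have "\<dots> \<le> nrm f * nrm g"
    by (rule suminf_le_const[OF inner_summable_norm[OF assms] inner_partial_sum_le[OF assms]])
  finally show ?thesis .
qed

lemma inner_commute:
  assumes "f \<in> H" "g \<in> H"
  shows "ip f g = cnj (ip g f)"
proof (rule sums_unique2[OF inner_sums[OF assms]])
  have "(\<lambda>j. cnj (taylor_coeff g j * cnj (taylor_coeff f j) * of_real (wt j))) sums cnj (ip g f)"
    using inner_sums[OF assms(2,1)] by (simp only: sums_cnj)
  then show "(\<lambda>j. taylor_coeff f j * cnj (taylor_coeff g j) * of_real (wt j)) sums cnj (ip g f)"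
    by (simp add: mult_ac)
qed

lemma inner_add_left:
  assumes "f \<in> H" "g \<in> H" "h \<in> H"
  shows "ip (\<lambda>z. f z + g z) h = ip f h + ip g h"
proof (rule sums_unique2[OF inner_sums[OF H_add[OF assms(1,2)] assms(3)]])
  show "(\<lambda>j. taylor_coeff (\<lambda>z. f z + g z) j * cnj (taylor_coeff h j) * of_real (wt j))
      sums (ip f h + ip g h)"
    using sums_add[OF inner_sums[OF assms(1,3)] inner_sums[OF assms(2,3)]] assms
    by (simp add: taylor_coeff_add H_holomorphic algebra_simps)
qed

lemma inner_cmult_left:
  assumes "f \<in> H" "g \<in> H"
  shows "ip (\<lambda>z. c * f z) g = c * ip f g"
proof (rule sums_unique2[OF inner_sums[OF H_cmult[OF assms(1)] assms(2)]])
  show "(\<lambda>j. taylor_coeff (\<lambda>z. c * f z) j * cnj (taylor_coeff g j) * of_real (wt j))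
      sums (c * ip f g)"
    using sums_mult[OF inner_sums[OF assms], of c] assms
    by (simp add: taylor_coeff_cmult H_holomorphic mult_ac)
qed

text \<open>Pairing with a monomial isolates one coefficient; this is the passage between matrix
  entries and Taylor coefficients.\<close>

lemma inner_disk_monomial:
  assumes "f \<in> H"
  shows "ip f (disk_monomial k) = taylor_coeff f k * of_real (wt k)"
proof (rule sums_unique2[OF inner_sums[OF assms H_disk_monomial]])
  have "(\<lambda>j. if j = k then taylor_coeff f j * of_real (wt j) else 0)
      sums (taylor_coeff f k * of_real (wt k))"
    by (rule sums_single)
  moreover have "(\<lambda>j. if j = k then taylor_coeff f j * complex_of_real (wt j) else 0)
    = (\<lambda>j. taylor_coeff f j * cnj (taylor_coeff (disk_monomial k) j) * of_real (wt j))"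
    by (auto simp: taylor_coeff_disk_monomial)
  ultimately show "(\<lambda>j. taylor_coeff f j * cnj (taylor_coeff (disk_monomial k) j) * of_real (wt j))
      sums (taylor_coeff f k * of_real (wt k))"
    by simp
qed

section \<open>Bounded operators and their adjoints\<close>

lemma bounded_opD:
  assumes "bounded_op \<alpha> T"
  shows "f \<in> H \<Longrightarrow> T f \<in> H"
    and "f \<in> H \<Longrightarrow> g \<in> H \<Longrightarrow> T (\<lambda>z. f z + g z) = (\<lambda>z. T f z + T g z)"
    and "f \<in> H \<Longrightarrow> T (\<lambda>z. k * f z) = (\<lambda>z. k * T f z)"
  using assms by (auto simp: bounded_op_def)

lemma bounded_op_bound: "bounded_op \<alpha> T \<Longrightarrow> \<exists>K. \<forall>f\<in>H. nrm (T f) \<le> K * nrm f"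
  by (simp add: bounded_op_def)

lemma bounded_op_sum:
  assumes "bounded_op \<alpha> T" "\<And>j. j \<in> A \<Longrightarrow> f j \<in> H"
  shows "T (\<lambda>z. \<Sum>j\<in>A. f j z) = (\<lambda>z. \<Sum>j\<in>A. T (f j) z)"
  using assms(2)
proof (induction A rule: infinite_finite_induct)
  case (insert x F)
  then show ?case
    by (simp add: bounded_opD(2)[OF assms(1)] H_sum)
qed (use bounded_opD(3)[OF assms(1) H_zero, of 0] in simp_all)

lemma inner_sum_left:
  assumes "\<And>j. j \<in> A \<Longrightarrow> f j \<in> H" "g \<in> H"
  shows "ip (\<lambda>z. \<Sum>j\<in>A. f j z) g = (\<Sum>j\<in>A. ip (f j) g)"
  using assms(1)
proof (induction A rule: infinite_finite_induct)
  case (insert x F)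
  then show ?case
    by (simp add: inner_add_left H_sum assms)
qed (use inner_cmult_left[OF H_zero assms(2), of 0] in simp_all)

text \<open>The Taylor polynomials of \<open>f\<close> converge to \<open>f\<close> in norm, so a bounded operator is
  determined by its matrix with respect to the monomials.\<close>

lemma inner_bounded_op_sums:
  assumes T: "bounded_op \<alpha> T" and f: "f \<in> H" and g: "g \<in> H"
  shows "(\<lambda>j. taylor_coeff f j * ip (T (disk_monomial j)) g) sums ip (T f) g"
proof -
  define P where "P N z = (\<Sum>j<N. taylor_coeff f j * disk_monomial j z)" for N z
  define R where "R N z = f z + (- 1) * P N z" for N z
  from bounded_op_bound[OF T] obtain K where K: "\<forall>f\<in>H. nrm (T f) \<le> K * nrm f" ..
  have PH: "P N \<in> H" for N
    unfolding P_def by (intro H_sum H_cmult H_disk_monomial)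
  have RH: "R N \<in> H" for N
    unfolding R_def by (intro H_add H_cmult f PH)
  have coeff_P: "taylor_coeff (P N) k = (if k < N then taylor_coeff f k else 0)" for N k
  proof -
    have "taylor_coeff (P N) k = (\<Sum>j<N. taylor_coeff f j * (if k = j then 1 else 0))"
      unfolding P_def
      by (subst taylor_coeff_sum)
        (simp_all add: H_cmult H_disk_monomial taylor_coeff_cmult disk_monomial_holomorphic
          taylor_coeff_disk_monomial)
    also have "\<dots> = (\<Sum>j<N. if k = j then taylor_coeff f j else 0)"
      by (intro sum.cong) auto
    finally show ?thesis
      by simp
  qed
  have coeff_R: "taylor_coeff (R N) k = (if k < N then 0 else taylor_coeff f k)" for N k
    unfolding R_def
    by (subst taylor_coeff_add)
      (auto simp: f PH H_cmult H_holomorphic taylor_coeff_cmult[of _ "-1", simplified] coeff_P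
        intro!: holomorphic_intros)
  define s where "s j = (cmod (taylor_coeff f j))\<^sup>2 * wt j" for j
  have nrm_R: "nrm (R N) = sqrt (\<Sum>j. s (j + N))" for N
  proof -
    have "(\<Sum>j. (cmod (taylor_coeff (R N) j))\<^sup>2 * wt j)
        = (\<Sum>j. (cmod (taylor_coeff (R N) (j + N)))\<^sup>2 * wt (j + N))"
      by (subst suminf_split_initial_segment[OF H_summable[OF RH], of _ N]) (simp add: coeff_R)
    then show ?thesis
      by (simp add: bergman_norm_def s_def coeff_R)
  qed
  have "(\<lambda>N. \<Sum>j. s (j + N)) \<longlonglongrightarrow> 0"
  proof (rule LIMSEQ_I)
    fix r :: real assume "r > 0"
    moreover have "summable s"
      using H_summable[OF f] by (simp add: s_def[abs_def])
    ultimately show "\<exists>N. \<forall>n\<ge>N. norm ((\<Sum>j. s (j + n)) - 0) < r"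
      using suminf_exist_split[of r s] by simp
  qed
  then have "(\<lambda>N. sqrt (\<Sum>j. s (j + N))) \<longlonglongrightarrow> sqrt 0"
    by (rule tendsto_real_sqrt)
  then have "(\<lambda>N. nrm (R N)) \<longlonglongrightarrow> 0"
    by (simp add: nrm_R)
  then have lim: "(\<lambda>N. K * nrm (R N) * nrm g) \<longlonglongrightarrow> 0"
    using tendsto_mult_left_zero tendsto_mult_right_zero by blast
  \<comment> \<open>Boundedness of \<open>T\<close> enters here: the norm of the Taylor remainder
    \<open>R N\<close> is the root of a tail of a convergent series, hence its image contributes
    nothing in the limit.\<close>
  have "cmod (ip (T (R N)) g) \<le> K * nrm (R N) * nrm g" for N
    using inner_Cauchy_Schwarz[OF bounded_opD(1)[OF T RH] g] mult_right_mono[OF bspec[OF K RH] norm_nonneg[OF g]]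
    by (rule order_trans)
  then have lim': "(\<lambda>N. ip (T (R N)) g) \<longlonglongrightarrow> 0"
    by (intro Lim_null_comparison[OF _ lim] always_eventually) simp
  have TP: "ip (T (P N)) g = (\<Sum>j<N. taylor_coeff f j * ip (T (disk_monomial j)) g)" for N
  proof -
    have "T (P N) = (\<lambda>z. \<Sum>j<N. taylor_coeff f j * T (disk_monomial j) z)"
      unfolding P_def
      by (subst bounded_op_sum[OF T])
        (simp_all add: H_cmult H_disk_monomial bounded_opD(3)[OF T])
    then show ?thesis
      by (simp add: inner_sum_left inner_cmult_left g H_cmult H_disk_monomial bounded_opD(1)[OF T])
  qed
  have "T f = (\<lambda>z. T (P N) z + T (R N) z)" for N
    using bounded_opD(2)[OF T PH RH, of N N] by (simp add: R_def)
  then have "ip (T f) g = ip (T (P N)) g + ip (T (R N)) g" for N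
    using inner_add_left[OF bounded_opD(1)[OF T PH] bounded_opD(1)[OF T RH] g] by metis
  then have "(\<Sum>j<N. taylor_coeff f j * ip (T (disk_monomial j)) g)
      = ip (T f) g - ip (T (R N)) g" for N
    by (metis TP add_diff_cancel_right')
  moreover have "(\<lambda>N. ip (T f) g - ip (T (R N)) g) \<longlonglongrightarrow> ip (T f) g - 0"
    by (intro tendsto_intros lim')
  ultimately show ?thesis
    by (simp add: sums_def)
qed

text \<open>The adjoint is carried as an explicit bounded operator \<open>S\<close>, since
  \<open>hadjoint\<close> is a definite description. Exhibiting \<open>S\<close> in each case
  replaces an appeal to Riesz representation.\<close>

definition adjoint_pair :: "fun_op \<Rightarrow> fun_op \<Rightarrow> bool" where
  "adjoint_pair T S \<longleftrightarrow> bounded_op \<alpha> T \<and> bounded_op \<alpha> S \<and>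
     (\<forall>f\<in>H. \<forall>g\<in>H. ip (T f) g = ip f (S g))"

text \<open>Agreement of the matrices suffices, because both sides are sums over Taylor
  coefficients: the identity is extended from monomials first in \<open>g\<close>, then in
  \<open>f\<close>.\<close>

lemma adjoint_pairI:
  assumes T: "bounded_op \<alpha> T" and S: "bounded_op \<alpha> S"
    and TS: "\<And>j k. ip (T (disk_monomial j)) (disk_monomial k)
      = ip (disk_monomial j) (S (disk_monomial k))"
  shows "adjoint_pair T S"
proof -
  note H_intros = bounded_opD(1)[OF T] bounded_opD(1)[OF S] H_disk_monomial
  \<comment> \<open>Applied to the identity operator, \<open>inner_bounded_op_sums\<close> expands a
    plain inner product in the coefficients of its first argument.\<close>
  have id: "bounded_op \<alpha> (\<lambda>f. f)"
    by (auto simp: bounded_op_def intro: exI[of _ 1])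
  have mono: "ip (T (disk_monomial j)) g = ip (disk_monomial j) (S g)" if g: "g \<in> H" for g j
  proof -
    have "(\<lambda>k. taylor_coeff g k * ip (disk_monomial k) (T (disk_monomial j)))
        sums ip g (T (disk_monomial j))"
      by (rule inner_bounded_op_sums[OF id g]) (intro H_intros)
    moreover have "ip (disk_monomial k) (T (disk_monomial j))
        = ip (S (disk_monomial k)) (disk_monomial j)" for k
      using inner_commute H_intros TS by metis
    moreover have "(\<lambda>k. taylor_coeff g k * ip (S (disk_monomial k)) (disk_monomial j))
        sums ip (S g) (disk_monomial j)"
      by (rule inner_bounded_op_sums[OF S g]) (intro H_intros)
    ultimately have "ip g (T (disk_monomial j)) = ip (S g) (disk_monomial j)"
      using sums_unique2 by simp
    then show ?thesis
      using inner_commute H_intros g by metis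
  qed
  have "ip (T f) g = ip f (S g)" if "f \<in> H" "g \<in> H" for f g
    using sums_unique2[OF inner_bounded_op_sums[OF T that]] mono[OF that(2)]
      inner_bounded_op_sums[OF id that(1), of "S g"] H_intros that(2) by simp
  then show ?thesis
    using T S by (simp add: adjoint_pair_def)
qed

text \<open>Testing against monomials determines every coefficient of a representing vector, so
  \<open>S g\<close> is the only one and the description denotes it.\<close>

lemma hadjoint_eq:
  assumes "adjoint_pair T S" "g \<in> H"
  shows "hadjoint \<alpha> T g = S g"
  unfolding hadjoint_def
proof (rule the_equality)
  note S = bounded_opD(1)[of S, OF _ assms(2)]
  show 1: "S g \<in> H \<and> (\<forall>f\<in>H. ip (T f) g = ip f (S g))"
    using assms S by (auto simp: adjoint_pair_def)
  fix h assume h: "h \<in> H \<and> (\<forall>f\<in>H. ip (T f) g = ip f h)"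
  show "h = S g"
  proof (rule H_eqI)
    fix k
    have "ip (disk_monomial k) h = ip (disk_monomial k) (S g)"
      using 1 h H_disk_monomial by metis
    then have "ip h (disk_monomial k) = ip (S g) (disk_monomial k)"
      using 1 h H_disk_monomial inner_commute by metis
    then show "taylor_coeff h k = taylor_coeff (S g) k"
      using 1 h weight_pos[of k] by (simp add: inner_disk_monomial)
  qed (use h 1 in auto)
qed

lemma normal_op_iff:
  assumes "adjoint_pair T S"
  shows "normal_op \<alpha> T \<longleftrightarrow> (\<forall>f\<in>H. T (S f) = S (T f))"
  using assms hadjoint_eq[OF assms] bounded_opD(1)[of T]
  by (auto simp: normal_op_def adjoint_pair_def)

section \<open>The conjugations formed from rotations and \<open>J\<close>\<close>

text \<open>This is the composite of the rotation by \<open>l\<close> with \<open>J\<close>, and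
  \<open>J\<close> itself for \<open>l = 1\<close>, so one family serves both symmetry
  claims.\<close>

definition twisted_conj :: "complex \<Rightarrow> fun_op" where
  "twisted_conj l f = (\<lambda>z. cnj (f (cnj (l * z))))"

text \<open>Conjugating the series of \<open>f\<close> at \<open>cnj (l * z)\<close> termwise turns
  the coefficients \<open>u k\<close> into \<open>cnj (u k) * l ^ k\<close>;
  \<open>cmod l = 1\<close> keeps that point in the disk.\<close>

lemma twisted_conj_sums:
  assumes "f \<in> H" "cmod l = 1" "z \<in> unit_disk"
  shows "(\<lambda>k. cnj (taylor_coeff f k) * l ^ k * z ^ k) sums twisted_conj l f z"
proof -
  have "cnj (l * z) \<in> unit_disk"
    using assms by (simp add: norm_mult)
  from holomorphic_unit_disk_sums[OF H_holomorphic[OF assms(1)] this]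
  have "(\<lambda>k. cnj (taylor_coeff f k * cnj (l * z) ^ k)) sums cnj (f (cnj (l * z)))"
    by (simp only: sums_cnj)
  then show ?thesis
    by (simp add: twisted_conj_def power_mult_distrib mult.assoc)
qed

lemma taylor_coeff_twisted_conj:
  assumes "f \<in> H" "cmod l = 1"
  shows "taylor_coeff (twisted_conj l f) k = cnj (taylor_coeff f k) * l ^ k"
  by (rule taylor_coeff_eqI) (rule twisted_conj_sums[OF assms])

lemma H_twisted_conj:
  assumes "f \<in> H" "cmod l = 1"
  shows "twisted_conj l f \<in> H"
proof (rule H_I[OF twisted_conj_sums[OF assms]])
  show "twisted_conj l f z = 0" if "z \<notin> unit_disk" for z
    using that assms H_outside[OF assms(1), of "cnj (l * z)"]
    by (simp add: twisted_conj_def norm_mult)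
  show "summable (\<lambda>j. (cmod (cnj (taylor_coeff f j) * l ^ j))\<^sup>2 * wt j)"
    using H_summable[OF assms(1)] assms(2) by (simp add: norm_mult norm_power)
qed

lemma norm_twisted_conj:
  assumes "f \<in> H" "cmod l = 1"
  shows "nrm (twisted_conj l f) = nrm f"
  using assms by (simp add: bergman_norm_def taylor_coeff_twisted_conj norm_mult norm_power)

lemma twisted_conj_involution:
  assumes "cmod l = 1"
  shows "twisted_conj l (twisted_conj l f) = f"
proof
  fix z
  have "l * cnj l = 1"
    using assms by (simp add: complex_norm_square[symmetric])
  moreover have "cnj (l * cnj (l * z)) = (l * cnj l) * z"
    by simp
  ultimately have "cnj (l * cnj (l * z)) = z"
    by (simp only: mult_1_left)
  then show "twisted_conj l (twisted_conj l f) z = f z"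
    unfolding twisted_conj_def by (simp only: complex_cnj_cnj)
qed

lemma conjugation_twisted_conj:
  assumes "cmod l = 1"
  shows "conjugation \<alpha> (twisted_conj l)"
  unfolding conjugation_def
  using assms H_twisted_conj norm_twisted_conj twisted_conj_involution
  by (simp add: twisted_conj_def)

text \<open>Scalars are conjugated once on the way in and once on the way out, so the composite is
  linear again; both conjugations preserve the norm.\<close>

lemma bounded_op_twisted_conj_conjugate:
  assumes T: "bounded_op \<alpha> T" and l: "cmod l = 1"
  shows "bounded_op \<alpha> (\<lambda>f. twisted_conj l (T (twisted_conj l f)))"
  unfolding bounded_op_def
proof (intro conjI ballI allI)
  note HC = H_twisted_conj[OF _ l] and TD = bounded_opD[OF T]
  show "twisted_conj l (T (twisted_conj l f)) \<in> H" if "f \<in> H" for f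
    by (intro HC TD that)
  show "twisted_conj l (T (twisted_conj l (\<lambda>z. f z + g z)))
      = (\<lambda>z. twisted_conj l (T (twisted_conj l f)) z + twisted_conj l (T (twisted_conj l g)) z)"
    if "f \<in> H" "g \<in> H" for f g
  proof -
    have "twisted_conj l (\<lambda>z. f z + g z) = (\<lambda>z. twisted_conj l f z + twisted_conj l g z)"
      by (simp add: twisted_conj_def)
    then have "T (twisted_conj l (\<lambda>z. f z + g z))
        = (\<lambda>z. T (twisted_conj l f) z + T (twisted_conj l g) z)"
      by (simp add: TD(2) HC that)
    then show ?thesis
      by (simp add: twisted_conj_def)
  qed
  show "twisted_conj l (T (twisted_conj l (\<lambda>z. k * f z)))
      = (\<lambda>z. k * twisted_conj l (T (twisted_conj l f)) z)" if "f \<in> H" for k f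
  proof -
    have "twisted_conj l (\<lambda>z. k * f z) = (\<lambda>z. cnj k * twisted_conj l f z)"
      by (simp add: twisted_conj_def)
    then have "T (twisted_conj l (\<lambda>z. k * f z)) = (\<lambda>z. cnj k * T (twisted_conj l f) z)"
      by (simp add: TD(3) HC that)
    then show ?thesis
      by (simp add: twisted_conj_def)
  qed
  from bounded_op_bound[OF T] obtain K where K: "\<forall>f\<in>H. nrm (T f) \<le> K * nrm f" ..
  have "nrm (twisted_conj l (T (twisted_conj l f))) \<le> K * nrm f" if "f \<in> H" for f
    using bspec[OF K HC[OF that]] by (simp add: norm_twisted_conj l TD(1) HC that)
  then show "\<exists>K. \<forall>f\<in>H. nrm (twisted_conj l (T (twisted_conj l f))) \<le> K * nrm f"
    by blast
qed

text \<open>Provides boundedness of the multiple of \<open>T\<close> that serves as its adjoint when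
  \<open>b\<close> is real.\<close>

lemma bounded_op_cmult:
  assumes T: "bounded_op \<alpha> T"
  shows "bounded_op \<alpha> (\<lambda>f z. k * T f z)"
proof -
  from bounded_op_bound[OF T] obtain K where K: "\<forall>f\<in>H. nrm (T f) \<le> K * nrm f" ..
  have "nrm (\<lambda>z. k * T f z) = cmod k * nrm (T f)" if "f \<in> H" for f
    using bounded_opD(1)[OF T that]
    by (simp add: bergman_norm_def taylor_coeff_cmult H_holomorphic norm_mult power_mult_distrib
        mult.assoc suminf_mult H_summable real_sqrt_mult)
  then have "nrm (\<lambda>z. k * T f z) \<le> cmod k * K * nrm f" if "f \<in> H" for f
    using mult_left_mono[OF bspec[OF K that], of "cmod k"] that by (simp add: mult.assoc)
  then have "\<exists>K. \<forall>f\<in>H. nrm (\<lambda>z. k * T f z) \<le> K * nrm f"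
    by blast
  then show ?thesis
    unfolding bounded_op_def
    using bounded_opD[OF T] H_cmult by (auto simp: algebra_simps)
qed

lemma inner_disk_monomial_left:
  assumes "f \<in> H"
  shows "ip (disk_monomial k) f = cnj (taylor_coeff f k) * of_real (wt k)"
  using inner_commute[OF H_disk_monomial assms, of k] inner_disk_monomial[OF assms] by simp

text \<open>The conjugation sends the \<open>k\<close>-th monomial to its multiple by
  \<open>l ^ k\<close>. Pairing the \<open>j\<close>-th monomial with the conjugated operator thus
  gives the transposed entry times \<open>cnj l ^ j * l ^ k\<close>, and the symmetry hypothesis
  together with \<open>cnj l * l = 1\<close> turns this into the original entry.\<close>

lemma adjoint_pair_twisted_conj:
  assumes T: "bounded_op \<alpha> T" and l: "cmod l = 1"
    and sym: "\<And>j k. ip (T (disk_monomial j)) (disk_monomial k) * l ^ j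
      = l ^ k * ip (T (disk_monomial k)) (disk_monomial j)"
  shows "adjoint_pair T (\<lambda>f. twisted_conj l (T (twisted_conj l f)))"
proof (rule adjoint_pairI[OF T bounded_op_twisted_conj_conjugate[OF T l]])
  fix j k
  have Ck: "twisted_conj l (disk_monomial k) = (\<lambda>z. l ^ k * disk_monomial k z)"
  proof (rule H_eqI)
    show "taylor_coeff (twisted_conj l (disk_monomial k)) i
        = taylor_coeff (\<lambda>z. l ^ k * disk_monomial k z) i" for i
      by (simp add: taylor_coeff_twisted_conj H_disk_monomial l taylor_coeff_cmult
          disk_monomial_holomorphic taylor_coeff_disk_monomial)
  qed (intro H_twisted_conj H_disk_monomial l H_cmult)+
  have TH: "T (disk_monomial i) \<in> H" for i
    by (rule bounded_opD(1)[OF T H_disk_monomial])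
  have TC: "T (twisted_conj l (disk_monomial k)) = (\<lambda>z. l ^ k * T (disk_monomial k) z)"
    unfolding Ck by (rule bounded_opD(3)[OF T H_disk_monomial])
  have unit: "cnj l ^ j * l ^ j = 1"
    using l by (simp add: power_mult_distrib[symmetric] complex_norm_square[symmetric] mult.commute)
  have "ip (disk_monomial j) (twisted_conj l (T (twisted_conj l (disk_monomial k))))
      = cnj l ^ j * (l ^ k * ip (T (disk_monomial k)) (disk_monomial j))"
    unfolding TC
    by (simp add: inner_disk_monomial_left inner_disk_monomial H_twisted_conj H_cmult TH l
        taylor_coeff_twisted_conj taylor_coeff_cmult H_holomorphic)
  also have "\<dots> = ip (T (disk_monomial j)) (disk_monomial k)"
    unfolding sym[symmetric] using unit by (simp add: mult_ac)
  finally show "ip (T (disk_monomial j)) (disk_monomial k)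
      = ip (disk_monomial j) (twisted_conj l (T (twisted_conj l (disk_monomial k))))" ..
qed

text \<open>If the adjoint is \<open>C T C\<close>, then conjugating it by \<open>C\<close> once
  more returns \<open>T\<close>, as \<open>C\<close> is an involution.\<close>

lemma C_symmetric_twisted_conj:
  assumes "adjoint_pair T (\<lambda>f. twisted_conj l (T (twisted_conj l f)))" and l: "cmod l = 1"
  shows "C_symmetric \<alpha> (twisted_conj l) T"
  using assms(1) hadjoint_eq[OF assms(1) H_twisted_conj[OF _ l]]
  by (simp add: C_symmetric_def adjoint_pair_def conjugation_twisted_conj[OF l]
      twisted_conj_involution[OF l])

end

section \<open>Binomial series and derivatives of monomials\<close>

lemma negative_binomial_sums:
  assumes "cmod c < 1" "z \<in> unit_disk"
  shows "(\<lambda>k. (if k < l then 0 else cnj c ^ (k - l) * of_real (pochhammer s (k - l) / fact (k - l)))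
    * z ^ k) sums (z ^ l * (1 - cnj c * z) powr (- of_real s))"
proof -
  have "cmod (- (cnj c * z)) < 1"
    using assms mult_strict_mono[of "cmod c" 1 "cmod z" 1] by (simp add: norm_mult)
  from gen_binomial_complex[OF this, of "- of_real s"]
  have "(\<lambda>k. (- of_real s gchoose k) * (- (cnj c * z)) ^ k) sums (1 - cnj c * z) powr (- of_real s)"
    by simp
  \<comment> \<open>The signs of the negative exponent and of the negative argument cancel, leaving
    a rising factorial.\<close>
  moreover have "(- of_real s gchoose k) * (- (cnj c * z)) ^ k
      = cnj c ^ k * of_real (pochhammer s k / fact k) * z ^ k" for k
    using power_minus[of "cnj c * z" k]
    by (simp add: gbinomial_pochhammer pochhammer_of_real power_mult_distrib)
  ultimately have "(\<lambda>k. z ^ l * (cnj c ^ k * of_real (pochhammer s k / fact k) * z ^ k))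
      sums (z ^ l * (1 - cnj c * z) powr (- of_real s))"
    by (intro sums_mult) simp
  then show ?thesis
    by (subst sums_zero_iff_shift[of l, symmetric]) (simp_all add: power_add mult_ac)
qed

lemma higher_deriv_disk_monomial:
  assumes "u \<in> unit_disk"
  shows "(deriv ^^ n) (disk_monomial j) u
    = (if j < n then 0 else fact j / fact (j - n) * u ^ (j - n))"
proof -
  have "(deriv ^^ n) (disk_monomial j) u = (deriv ^^ n) (\<lambda>w. (w - 0) ^ j) u"
    using assms
    by (intro higher_deriv_transform_within_open[OF disk_monomial_holomorphic])
      (auto intro!: holomorphic_intros simp: disk_monomial_def)
  also have "\<dots> = pochhammer (of_nat (Suc j - n)) n * u ^ (j - n)"
    by (subst higher_deriv_power) simp
  \<comment> \<open>For \<open>j < n\<close> the truncated difference \<open>Suc j - n\<close> is 0,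
    and the Pochhammer symbol at 0 of positive length \<open>n\<close> vanishes.\<close>
  also have "\<dots> = (if j < n then 0 else fact j / fact (j - n) * u ^ (j - n))"
  proof (cases "j < n")
    case False
    then have "pochhammer 1 j = pochhammer (1::complex) (j - n) * pochhammer (1 + of_nat (j - n)) n"
      using pochhammer_product[of "j - n" j "1::complex"] by simp
    moreover have "of_nat (Suc j - n) = (1 + of_nat (j - n) :: complex)"
      using False by (simp add: Suc_diff_le)
    ultimately show ?thesis
      using False by (simp only: pochhammer_fact[symmetric]) simp
  qed (simp add: pochhammer_0_left)
  finally show ?thesis .
qed

section \<open>Diagonal operators, normality, and the matrix entries\<close>

context weighted_bergman
begin

text \<open>Only the term \<open>j = k\<close> survives in the matrix expansion of
  \<open>T f\<close>. Two diagonal operators hence act by scalars on each coefficient and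
  commute.\<close>

lemma taylor_coeff_diagonal_op:
  assumes T: "bounded_op \<alpha> T"
    and diag: "\<And>j k. j \<noteq> k \<Longrightarrow> ip (T (disk_monomial j)) (disk_monomial k) = 0"
    and f: "f \<in> H"
  shows "taylor_coeff (T f) k = taylor_coeff f k * taylor_coeff (T (disk_monomial k)) k"
proof -
  have "(\<lambda>j. taylor_coeff f j * ip (T (disk_monomial j)) (disk_monomial k))
      = (\<lambda>j. if j = k then taylor_coeff f j * ip (T (disk_monomial j)) (disk_monomial k) else 0)"
    using diag by auto
  moreover have "(\<lambda>j. taylor_coeff f j * ip (T (disk_monomial j)) (disk_monomial k))
      sums ip (T f) (disk_monomial k)"
    by (rule inner_bounded_op_sums[OF T f H_disk_monomial])
  ultimately have "ip (T f) (disk_monomial k)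
      = taylor_coeff f k * ip (T (disk_monomial k)) (disk_monomial k)"
    using sums_single[of k "\<lambda>j. taylor_coeff f j * ip (T (disk_monomial j)) (disk_monomial k)"]
    by (auto intro: sums_unique2)
  then show ?thesis
    using weight_pos[of k]
    by (simp add: inner_disk_monomial bounded_opD(1)[OF T] f H_disk_monomial)
qed

text \<open>The polarized form of the fact that a normal operator and its adjoint give images of
  equal norm.\<close>

lemma normal_inner_eq:
  assumes adj: "adjoint_pair T S" and "normal_op \<alpha> T" and f: "f \<in> H" and g: "g \<in> H"
  shows "ip (T f) (T g) = ip (S f) (S g)"
proof -
  have H: "T f \<in> H" "T g \<in> H" "S f \<in> H" "S g \<in> H" "T (S g) \<in> H"
    using adj f g bounded_opD(1)[of T] bounded_opD(1)[of S] by (auto simp: adjoint_pair_def)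
  have "ip (T f) (T g) = ip f (S (T g))"
    using adj f H by (simp add: adjoint_pair_def)
  also have "\<dots> = ip f (T (S g))"
    using assms(2) g by (simp add: normal_op_iff[OF adj])
  also have "\<dots> = cnj (ip (T (S g)) f)"
    by (rule inner_commute[OF f H(5)])
  also have "\<dots> = cnj (ip (S g) (S f))"
    using adj f H by (simp add: adjoint_pair_def)
  also have "\<dots> = ip (S f) (S g)"
    by (rule inner_commute[OF H(3,4), symmetric])
  finally show ?thesis .
qed

text \<open>This is the matrix of the operator without the factor \<open>a\<close>. The range of
  \<open>l\<close> keeps all differences in the exponents and factorials free of truncation;
  \<open>b\<close> is a parameter because the adjoint has the same form with
  \<open>cnj b\<close>.\<close>

definition matrix_entry :: "nat \<Rightarrow> complex \<Rightarrow> complex \<Rightarrow> nat \<Rightarrow> nat \<Rightarrow> complex" where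
  "matrix_entry n c b j k = (\<Sum>l\<in>{n..min j k}. b ^ (l - n) * c ^ (j - l) * cnj c ^ (k - l) *
     of_real (fact j * fact k /
       (fact n * fact (l - n) * fact (j - l) * fact (k - l) * pochhammer (\<alpha> + 2) l)))"

text \<open>The numerical factors are real and symmetric in \<open>j\<close> and \<open>k\<close>,
  and exchanging \<open>c\<close> with \<open>cnj c\<close> has the same effect as exchanging
  \<open>j\<close> with \<open>k\<close>.\<close>

lemma cnj_matrix_entry: "cnj (matrix_entry n c b j k) = matrix_entry n c (cnj b) k j"
  unfolding matrix_entry_def cnj_sum by (intro sum.cong) (auto simp: mult_ac min.commute)

text \<open>Writing \<open>cnj c\<close> as \<open>l * c\<close> leaves the same power of
  \<open>c\<close> on both sides; the powers of \<open>l\<close> agree because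
  \<open>(k - i) + j = (j - i) + k\<close>.\<close>

lemma matrix_entry_twist:
  assumes "l * c = cnj c"
  shows "matrix_entry n c b j k * l ^ j = l ^ k * matrix_entry n c b k j"
proof -
  have pow: "c ^ (j - i) * cnj c ^ (k - i) * l ^ j = c ^ (k - i) * cnj c ^ (j - i) * l ^ k"
    if "i \<le> j" "i \<le> k" for i
  proof -
    have "l ^ (k - i) * l ^ j = l ^ (j - i) * l ^ k"
      using that by (simp add: power_add[symmetric] add.commute)
    then show ?thesis
      unfolding assms[symmetric] power_mult_distrib by (simp add: mult_ac)
  qed
  have swap: "b ^ (i - n) * c ^ (j - i) * cnj c ^ (k - i) * d * l ^ j
      = l ^ k * (b ^ (i - n) * c ^ (k - i) * cnj c ^ (j - i) * d)" if "i \<le> j" "i \<le> k" for i d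
    using arg_cong[OF pow[OF that], of "\<lambda>x. b ^ (i - n) * d * x"]
    by (simp only: mult_ac)
  show ?thesis
    unfolding matrix_entry_def sum_distrib_left sum_distrib_right
  proof (rule sum.cong)
    fix i assume "i \<in> {n..min k j}"
    then show "b ^ (i - n) * c ^ (j - i) * cnj c ^ (k - i) * of_real (fact j * fact k /
        (fact n * fact (i - n) * fact (j - i) * fact (k - i) * pochhammer (\<alpha> + 2) i)) * l ^ j
      = l ^ k * (b ^ (i - n) * c ^ (k - i) * cnj c ^ (j - i) * of_real (fact k * fact j /
        (fact n * fact (i - n) * fact (k - i) * fact (j - i) * pochhammer (\<alpha> + 2) i)))"
      by (subst swap) (simp_all add: mult_ac)
  qed (simp add: min.commute)
qed

text \<open>For \<open>j\<close> different from \<open>k\<close>, every \<open>l\<close> in the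
  range leaves \<open>j - l\<close> or \<open>k - l\<close> positive, so each term contains a
  positive power of 0.\<close>

lemma matrix_entry_diagonal: "j \<noteq> k \<Longrightarrow> matrix_entry n 0 b j k = 0"
  unfolding matrix_entry_def by (intro sum.neutral) (auto simp: power_0_left)

text \<open>Only \<open>l = n\<close> is left, so the entry is independent of
  \<open>b\<close>.\<close>

lemma matrix_entry_column_n:
  "matrix_entry n c b n k = (if n \<le> k then cnj c ^ (k - n) *
     of_real (fact k / (fact (k - n) * pochhammer (\<alpha> + 2) n)) else 0)"
  by (auto simp: matrix_entry_def min_def)

text \<open>The terms for \<open>l = n\<close> do not involve \<open>b\<close> and cancel; the term
  for \<open>l = Suc n\<close> is linear in \<open>b\<close>.\<close>

lemma matrix_entry_column_Suc_n:
  "matrix_entry n c b (Suc n) k - matrix_entry n c b' (Suc n) k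
    = (if n < k then (b - b') * cnj c ^ (k - Suc n) * of_real (fact (Suc n) * fact k /
        (fact n * fact (k - Suc n) * pochhammer (\<alpha> + 2) (Suc n))) else 0)"
proof (cases "n < k")
  case True
  then have "{n..min (Suc n) k} = {n, Suc n}"
    by auto
  then show ?thesis
    using True by (simp add: matrix_entry_def algebra_simps diff_divide_distrib)
next
  case False
  then have "{n..min (Suc n) k} \<subseteq> {n}"
    by auto
  then have "matrix_entry n c b (Suc n) k = matrix_entry n c b' (Suc n) k"
    unfolding matrix_entry_def by (intro sum.cong) auto
  then show ?thesis
    using False by simp
qed

end

section \<open>The operator \<open>T\<close> and its matrix\<close>

locale comp_diff = weighted_bergman +
  fixes n :: nat and a b c :: complex and \<psi> \<phi> :: "complex \<Rightarrow> complex"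
  assumes c: "cmod c < 1"
    and psi: "\<And>z. z \<in> unit_disk \<Longrightarrow>
      \<psi> z = a * z ^ n / (fact n * (1 - cnj c * z) powr of_real (real n + \<alpha> + 2))"
    and phi: "\<And>z. z \<in> unit_disk \<Longrightarrow> \<phi> z = c + b * z / (1 - cnj c * z)"
    and phi_disk: "\<And>z. z \<in> unit_disk \<Longrightarrow> \<phi> z \<in> unit_disk"
    and bounded: "bounded_op \<alpha> (comp_diff_op \<psi> \<phi> n)"
begin

abbreviation "T \<equiv> comp_diff_op \<psi> \<phi> n"

lemma denominator_nonzero:
  assumes "z \<in> unit_disk"
  shows "1 - cnj c * z \<noteq> 0"
proof
  assume "1 - cnj c * z = 0"
  then have "cmod (cnj c * z) = 1"
    by simp
  then show False
    using c assms mult_strict_mono[of "cmod c" 1 "cmod z" 1] by (simp add: norm_mult)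
qed

text \<open>With \<open>q = 1 - cnj c * z\<close>, the \<open>n\<close>-th derivative of the
  monomial at \<open>\<phi> z\<close> is a multiple of \<open>(b * z / q + c) ^ (j - n)\<close>.
  Each \<open>q ^ m\<close> in the denominators of its binomial expansion merges with the power of
  \<open>q\<close> in \<open>\<psi>\<close>.\<close>

lemma T_monomial:
  assumes z: "z \<in> unit_disk"
  shows "T (disk_monomial j) z = (\<Sum>l\<in>{n..j}. a * b ^ (l - n) * c ^ (j - l) *
    of_real (fact j / (fact n * fact (l - n) * fact (j - l))) *
    (z ^ l * (1 - cnj c * z) powr (- of_real (real l + \<alpha> + 2))))"
proof (cases "j < n")
  case True
  then show ?thesis
    using z by (simp add: comp_diff_op_def higher_deriv_disk_monomial[OF phi_disk[OF z]])
next
  case False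
  then obtain p where j: "j = p + n"
    by (metis add.commute le_add_diff_inverse not_less)
  define q where "q = 1 - cnj c * z"
  have q: "q \<noteq> 0"
    using denominator_nonzero[OF z] by (simp add: q_def)
  have powr: "q powr (- of_real (real (m + n) + \<alpha> + 2))
      = inverse (q powr of_real (real n + \<alpha> + 2)) / q ^ m" for m
  proof -
    have "q powr of_real (real (m + n) + \<alpha> + 2)
        = q powr (of_nat m + of_real (real n + \<alpha> + 2))"
      by (simp add: algebra_simps)
    also have "\<dots> = q ^ m * q powr of_real (real n + \<alpha> + 2)"
      using q by (simp add: powr_add powr_complexpow)
    finally show ?thesis
      by (simp only: powr_minus) (simp add: field_simps)
  qed
  have "T (disk_monomial j) z = a * z ^ n / (fact n * q powr of_real (real n + \<alpha> + 2)) *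
      (fact j / fact p * (b * z / q + c) ^ p)"
    using z
    by (simp add: comp_diff_op_def higher_deriv_disk_monomial[OF phi_disk[OF z]] psi j q_def)
      (simp add: phi add.commute)
  also have "\<dots> = (\<Sum>m\<in>{0..p}. a * z ^ n / (fact n * q powr of_real (real n + \<alpha> + 2)) *
      (fact j / fact p * (of_nat (p choose m) * (b * z / q) ^ m * c ^ (p - m))))"
    by (simp only: binomial_ring sum_distrib_left atLeast0AtMost)
  also have "\<dots> = (\<Sum>m\<in>{0..p}. a * b ^ m * c ^ (p - m) *
    of_real (fact j / (fact n * fact m * fact (p - m))) *
    (z ^ (m + n) * q powr (- of_real (real (m + n) + \<alpha> + 2))))"
  proof (intro sum.cong refl)
    fix m assume "m \<in> {0..p}"
    then have "(of_nat (p choose m) :: complex) = fact p / (fact m * fact (p - m))"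
      by (simp add: binomial_fact)
    then show "a * z ^ n / (fact n * q powr of_real (real n + \<alpha> + 2)) *
        (fact j / fact p * (of_nat (p choose m) * (b * z / q) ^ m * c ^ (p - m)))
      = a * b ^ m * c ^ (p - m) * of_real (fact j / (fact n * fact m * fact (p - m))) *
        (z ^ (m + n) * q powr (- of_real (real (m + n) + \<alpha> + 2)))"
      unfolding powr by (simp add: power_add power_mult_distrib power_divide divide_simps)
  qed
  \<comment> \<open>The summation index is shifted to \<open>l = m + n\<close>.\<close>
  also have "\<dots> = (\<Sum>l\<in>{0 + n..p + n}. a * b ^ (l - n) * c ^ (j - l) *
    of_real (fact j / (fact n * fact (l - n) * fact (j - l))) *
    (z ^ l * q powr (- of_real (real l + \<alpha> + 2))))"
    unfolding sum.shift_bounds_cl_nat_ivl by (simp add: j)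
  finally show ?thesis
    by (simp add: j q_def)
qed

lemma inner_T_monomial:
  "ip (T (disk_monomial j)) (disk_monomial k) = a * matrix_entry n c b j k"
proof -
  define A where "A l = a * b ^ (l - n) * c ^ (j - l) *
    of_real (fact j / (fact n * fact (l - n) * fact (j - l)))" for l
  define B where "B l k = (if k < l then 0 else cnj c ^ (k - l) *
    complex_of_real (pochhammer (real l + \<alpha> + 2) (k - l) / fact (k - l)))" for l k
  have "(\<lambda>k. (\<Sum>l\<in>{n..j}. A l * B l k) * z ^ k) sums T (disk_monomial j) z"
    if "z \<in> unit_disk" for z
  proof -
    have "(\<lambda>k. \<Sum>l\<in>{n..j}. A l * (B l k * z ^ k)) sums T (disk_monomial j) z"
      unfolding T_monomial[OF that] A_def B_def
      by (intro sums_sum sums_mult negative_binomial_sums c that)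
    then show ?thesis
      by (simp add: sum_distrib_right mult.assoc)
  qed
  then have "taylor_coeff (T (disk_monomial j)) k = (\<Sum>l\<in>{n..j}. A l * B l k)"
    by (rule taylor_coeff_eqI)
  \<comment> \<open>Summands with \<open>l > k\<close> carry the factor \<open>z ^ l\<close> and
    contribute nothing to the \<open>k\<close>-th coefficient.\<close>
  also have "\<dots> = (\<Sum>l\<in>{n..min j k}. A l * B l k)"
    by (rule sum.mono_neutral_right) (auto simp: B_def)
  finally have "ip (T (disk_monomial j)) (disk_monomial k)
      = (\<Sum>l\<in>{n..min j k}. A l * B l k * of_real (wt k))"
    by (simp add: inner_disk_monomial bounded_opD(1)[OF bounded H_disk_monomial] sum_distrib_right)
  also have "\<dots> = (\<Sum>l\<in>{n..min j k}. a * (b ^ (l - n) * c ^ (j - l) * cnj c ^ (k - l) *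
     of_real (fact j * fact k /
       (fact n * fact (l - n) * fact (j - l) * fact (k - l) * pochhammer (\<alpha> + 2) l))))"
  proof (intro sum.cong refl)
    fix l assume l: "l \<in> {n..min j k}"
    \<comment> \<open>Splitting the Pochhammer symbol of the weight at \<open>l\<close> cancels the
      one from the binomial series; what remains is symmetric in \<open>j\<close> and
      \<open>k\<close>.\<close>
    have "pochhammer (\<alpha> + 2) k
        = pochhammer (\<alpha> + 2) l * pochhammer (real l + \<alpha> + 2) (k - l)"
      using l pochhammer_product[of l k "\<alpha> + 2"] by (simp add: add_ac)
    then have "fact j / (fact n * fact (l - n) * fact (j - l)) *
        (pochhammer (real l + \<alpha> + 2) (k - l) / fact (k - l)) * wt k
      = fact j * fact k /
       (fact n * fact (l - n) * fact (j - l) * fact (k - l) * pochhammer (\<alpha> + 2) l)"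
      using pochhammer_alpha_pos[of k] by (auto simp: weight_eq)
    from arg_cong[OF this, of "\<lambda>x. a * (b ^ (l - n) * c ^ (j - l) * cnj c ^ (k - l) * of_real x)"]
    show "A l * B l k * of_real (wt k) = a * (b ^ (l - n) * c ^ (j - l) * cnj c ^ (k - l) *
     of_real (fact j * fact k /
       (fact n * fact (l - n) * fact (j - l) * fact (k - l) * pochhammer (\<alpha> + 2) l)))"
      using l by (simp add: A_def B_def mult_ac)
  qed
  also have "\<dots> = a * matrix_entry n c b j k"
    by (simp add: matrix_entry_def sum_distrib_left)
  finally show ?thesis .
qed

lemma adjoint_pair_T_twisted_conj:
  assumes "cmod l = 1" "l * c = cnj c"
  shows "adjoint_pair T (\<lambda>f. twisted_conj l (T (twisted_conj l f)))"
proof (rule adjoint_pair_twisted_conj[OF bounded assms(1)])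
  show "ip (T (disk_monomial j)) (disk_monomial k) * l ^ j
      = l ^ k * ip (T (disk_monomial k)) (disk_monomial j)" for j k
    unfolding inner_T_monomial mult.assoc matrix_entry_twist[OF assms(2)] by (rule mult.left_commute)
qed

section \<open>Normality of \<open>T\<close>\<close>

text \<open>For real \<open>b\<close> the matrix without the factor \<open>a\<close> is Hermitian by
  \<open>cnj_matrix_entry\<close>, so the adjoint of \<open>T\<close> is \<open>cnj a / a\<close>
  times \<open>T\<close>, which commutes with \<open>T\<close> by linearity.\<close>

lemma normal_if_real:
  assumes "a \<noteq> 0" "b \<in> \<real>"
  shows "normal_op \<alpha> T"
proof -
  let ?S = "\<lambda>f z. cnj a / a * T f z"
  have TH: "f \<in> H \<Longrightarrow> T f \<in> H" for f
    by (rule bounded_opD(1)[OF bounded])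
  have "adjoint_pair T ?S"
  proof (rule adjoint_pairI[OF bounded bounded_op_cmult[OF bounded]])
    fix j k
    have "ip (disk_monomial j) (?S (disk_monomial k))
        = cnj (cnj a / a * ip (T (disk_monomial k)) (disk_monomial j))"
      by (subst inner_commute)
        (simp_all only: H_disk_monomial H_cmult TH inner_cmult_left)
    also have "\<dots> = a * matrix_entry n c (cnj b) j k"
      using assms(1) by (simp add: inner_T_monomial cnj_matrix_entry)
    also have "cnj b = b"
      using assms(2) by (simp add: Reals_cnj_iff)
    finally show "ip (T (disk_monomial j)) (disk_monomial k)
        = ip (disk_monomial j) (?S (disk_monomial k))"
      by (simp add: inner_T_monomial)
  qed
  then show ?thesis
    using bounded_opD(3)[OF bounded TH] unfolding normal_op_iff[OF \<open>adjoint_pair T ?S\<close>] by blast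
qed

text \<open>Here \<open>l = 1\<close> satisfies \<open>l * c = cnj c\<close>. Both \<open>T\<close>
  and its adjoint are diagonal, hence commute.\<close>

lemma normal_if_zero:
  assumes "c = 0"
  shows "normal_op \<alpha> T"
proof -
  let ?S = "\<lambda>f. twisted_conj 1 (T (twisted_conj 1 f))"
  have adj: "adjoint_pair T ?S"
    by (rule adjoint_pair_T_twisted_conj) (simp_all add: assms)
  then have S: "bounded_op \<alpha> ?S"
    by (simp add: adjoint_pair_def)
  have T0: "ip (T (disk_monomial j)) (disk_monomial k) = 0" if "j \<noteq> k" for j k
    using that by (simp add: inner_T_monomial assms matrix_entry_diagonal)
  have S0: "ip (?S (disk_monomial j)) (disk_monomial k) = 0" if "j \<noteq> k" for j k
  proof -
    have "ip (?S (disk_monomial j)) (disk_monomial k) = cnj (ip (T (disk_monomial k)) (disk_monomial j))"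
      using adj inner_commute[OF bounded_opD(1)[OF S H_disk_monomial] H_disk_monomial]
      by (simp add: adjoint_pair_def H_disk_monomial)
    then show ?thesis
      using T0 that by simp
  qed
  have "T (?S f) = ?S (T f)" if "f \<in> H" for f
  proof (rule H_eqI)
    show "taylor_coeff (T (?S f)) k = taylor_coeff (?S (T f)) k" for k
      using that bounded_opD(1)[OF S] bounded_opD(1)[OF bounded]
      by (simp add: taylor_coeff_diagonal_op[OF bounded T0] taylor_coeff_diagonal_op[OF S S0])
  qed (intro that bounded_opD(1)[OF S] bounded_opD(1)[OF bounded])+
  then show ?thesis
    by (simp add: normal_op_iff[OF adj])
qed

lemma normal_imp_real:
  assumes normal: "normal_op \<alpha> T" and a: "a \<noteq> 0" and c0: "c \<noteq> 0"
    and l: "cmod l = 1" "l * c = cnj c"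
  shows "b \<in> \<real>"
proof (rule ccontr)
  assume "b \<notin> \<real>"
  then have b: "cnj b - b \<noteq> 0"
    by (simp add: Reals_cnj_iff)
  let ?S = "\<lambda>f. twisted_conj l (T (twisted_conj l f))"
  have adj: "adjoint_pair T ?S"
    by (rule adjoint_pair_T_twisted_conj[OF l])
  then have S: "bounded_op \<alpha> ?S"
    by (simp add: adjoint_pair_def)
  note TH = bounded_opD(1)[OF bounded H_disk_monomial] and SH = bounded_opD(1)[OF S H_disk_monomial]
  have T_coeff: "taylor_coeff (T (disk_monomial j)) k * of_real (wt k) = a * matrix_entry n c b j k"
    for j k
    using inner_T_monomial inner_disk_monomial[OF TH] by metis
  \<comment> \<open>The adjoint has the conjugate transpose as its matrix, which is the same
    expression with \<open>cnj a\<close> and \<open>cnj b\<close>.\<close>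
  have S_coeff: "taylor_coeff (?S (disk_monomial j)) k * of_real (wt k)
      = cnj a * matrix_entry n c (cnj b) j k" for j k
  proof -
    have "ip (?S (disk_monomial j)) (disk_monomial k) = cnj (ip (T (disk_monomial k)) (disk_monomial j))"
      using adj inner_commute[OF SH H_disk_monomial]
      by (simp add: adjoint_pair_def H_disk_monomial)
    then show ?thesis
      by (simp add: inner_disk_monomial[OF SH] inner_T_monomial cnj_matrix_entry)
  qed
  \<comment> \<open>\<open>P k\<close> collects the nonnegative real factors of the difference of
    the \<open>k\<close>-th terms of the two inner products. At \<open>k = Suc n\<close> the power
    of \<open>cmod c\<close> is 1, so this value is positive.\<close>
  define P where "P k = (if n < k then (cmod c ^ (k - Suc n))\<^sup>2 *
    (fact k / (fact (k - n) * pochhammer (\<alpha> + 2) n)) *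
    (fact (Suc n) * fact k / (fact n * fact (k - Suc n) * pochhammer (\<alpha> + 2) (Suc n))) / wt k
    else 0)" for k
  have P_nonneg: "P k \<ge> 0" for k
    using pochhammer_alpha_pos[of n] pochhammer_alpha_pos[of "Suc n"] weight_pos[of k]
    by (auto simp: P_def intro!: mult_nonneg_nonneg divide_nonneg_nonneg less_imp_le)
  have "P (Suc n) > 0"
    using pochhammer_alpha_pos[of n] pochhammer_alpha_pos[of "Suc n"] weight_pos[of "Suc n"]
    by (simp add: P_def)
  define t where "t k = taylor_coeff (T (disk_monomial n)) k *
    cnj (taylor_coeff (T (disk_monomial (Suc n))) k) * of_real (wt k)" for k
  define s where "s k = taylor_coeff (?S (disk_monomial n)) k *
    cnj (taylor_coeff (?S (disk_monomial (Suc n))) k) * of_real (wt k)" for k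
  have ts: "t k - s k = a * cnj a * (cnj b - b) * cnj c * of_real (P k)" for k
  proof -
    let ?w = "complex_of_real (wt k)"
    have w: "?w \<noteq> 0"
      using weight_pos[of k] by simp
    \<comment> \<open>One more factor of the weight turns both Taylor coefficients into matrix
      entries.\<close>
    have "t k * ?w = (a * matrix_entry n c b n k) * cnj (a * matrix_entry n c b (Suc n) k)"
      unfolding T_coeff[symmetric] t_def by simp
    moreover have "s k * ?w = (cnj a * matrix_entry n c b n k)
        * cnj (cnj a * matrix_entry n c (cnj b) (Suc n) k)"
      using S_coeff[of n k] S_coeff[of "Suc n" k, symmetric]
      unfolding s_def by (simp add: matrix_entry_column_n)
    ultimately have "(t k - s k) * ?w = a * cnj a * matrix_entry n c b n k *
        cnj (matrix_entry n c b (Suc n) k - matrix_entry n c (cnj b) (Suc n) k)"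
      by (simp add: algebra_simps)
    also have "\<dots> = a * cnj a * (cnj b - b) * cnj c * of_real (P k) * ?w"
    proof (cases "n < k")
      case True
      \<comment> \<open>The exponents of \<open>cnj c\<close> and \<open>c\<close> differ by one:
        pairing them gives a squared modulus and leaves a single \<open>cnj c\<close>, which does
        not depend on \<open>k\<close>.\<close>
      then have "k - n = Suc (k - Suc n)"
        by simp
      moreover have "of_real ((cmod c ^ (k - Suc n))\<^sup>2) = c ^ (k - Suc n) * cnj c ^ (k - Suc n)"
        using complex_norm_square[of "c ^ (k - Suc n)"] by (simp add: norm_power)
      ultimately have cc: "cnj c ^ (k - n) * c ^ (k - Suc n)
          = cnj c * of_real ((cmod c ^ (k - Suc n))\<^sup>2)"
        by (simp only: power_Suc mult_ac)
      define q where "q = fact k / (fact (k - n) * pochhammer (\<alpha> + 2) n)"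
      define r where "r = fact (Suc n) * fact k
        / (fact n * fact (k - Suc n) * pochhammer (\<alpha> + 2) (Suc n))"
      have "P k = (cmod c ^ (k - Suc n))\<^sup>2 * q * r / wt k"
        using True by (simp only: P_def q_def r_def if_True)
      then have Pw: "of_real (P k) * ?w = of_real ((cmod c ^ (k - Suc n))\<^sup>2) * of_real q * of_real r"
        using w by simp
      have "matrix_entry n c b n k = cnj c ^ (k - n) * of_real q"
        using True by (simp add: matrix_entry_column_n q_def)
      moreover have "cnj (matrix_entry n c b (Suc n) k - matrix_entry n c (cnj b) (Suc n) k)
          = (cnj b - b) * c ^ (k - Suc n) * of_real r"
        using True unfolding matrix_entry_column_Suc_n r_def by simp
      ultimately have "a * cnj a * matrix_entry n c b n k *
          cnj (matrix_entry n c b (Suc n) k - matrix_entry n c (cnj b) (Suc n) k)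
        = a * cnj a * (cnj b - b) * (cnj c ^ (k - n) * c ^ (k - Suc n)) * (of_real q * of_real r)"
        by (simp only: mult_ac)
      also have "\<dots> = a * cnj a * (cnj b - b) * cnj c * (of_real (P k) * ?w)"
        unfolding cc Pw by (simp only: mult_ac)
      finally show ?thesis
        by (simp only: mult.assoc)
    qed (simp add: matrix_entry_column_Suc_n P_def)
    finally show ?thesis
      using w by simp
  qed
  have "ip (T (disk_monomial n)) (T (disk_monomial (Suc n)))
      = ip (?S (disk_monomial n)) (?S (disk_monomial (Suc n)))"
    by (rule normal_inner_eq[OF adj normal H_disk_monomial H_disk_monomial])
  then have "(\<lambda>k. t k - s k) sums 0"
    using sums_diff[OF inner_sums[OF TH[of n] TH[of "Suc n"]] inner_sums[OF SH[of n] SH[of "Suc n"]]]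
    by (simp add: t_def s_def)
  moreover have "a * cnj a * (cnj b - b) * cnj c \<noteq> 0"
    using a b c0 by simp
  ultimately have "(\<lambda>k. complex_of_real (P k)) sums of_real 0"
    using sums_mult_D[of "a * cnj a * (cnj b - b) * cnj c" "\<lambda>k. of_real (P k)" 0]
    unfolding ts by simp
  then have "P sums 0"
    by (simp only: sums_of_real_iff)
  then have "P (Suc n) = 0"
    using suminf_eq_zero_iff[of P] P_nonneg by (simp add: sums_iff)
  with \<open>P (Suc n) > 0\<close> show False
    by simp
qed

end

section \<open>The normality criterion and the complex symmetries\<close>

theorem proposition3p3:
  fixes \<alpha> :: real and n :: nat and a b c :: complex and \<psi> \<phi> :: "complex \<Rightarrow> complex"
  assumes "\<alpha> > -1" and "n > 0" and "a \<noteq> 0" and "b \<noteq> 0" and "c \<in> unit_disk"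
    and "\<And>z. z \<in> unit_disk \<Longrightarrow>
           \<psi> z = a * z ^ n / (fact n * (1 - cnj c * z) powr of_real (real n + \<alpha> + 2))"
    and "\<And>z. z \<in> unit_disk \<Longrightarrow> \<phi> z = c + b * z / (1 - cnj c * z)"
    and "\<phi> ` unit_disk \<subseteq> unit_disk"
    and "bounded_op \<alpha> (comp_diff_op \<psi> \<phi> n)"
  shows "(normal_op \<alpha> (comp_diff_op \<psi> \<phi> n) \<longleftrightarrow> b \<in> \<real> - {0} \<or> c = 0) \<and>
    (normal_op \<alpha> (comp_diff_op \<psi> \<phi> n) \<longrightarrow>
      (c = 0 \<longrightarrow> C_symmetric \<alpha> conj_J (comp_diff_op \<psi> \<phi> n)) \<and>
      (c \<noteq> 0 \<longrightarrow> C_symmetric \<alpha>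
         (rotation_op (exp (- 2 * \<i> * of_real (Arg2pi c))) \<circ> conj_J) (comp_diff_op \<psi> \<phi> n)))"
proof -
  interpret comp_diff \<alpha> n a b c \<psi> \<phi>
    by unfold_locales (use assms in \<open>simp_all add: image_subset_iff\<close>)
  define l where "l = exp (- 2 * \<i> * of_real (Arg2pi c))"
  have l: "cmod l = 1"
    by (simp add: l_def norm_exp_eq_Re)
  \<comment> \<open>In polar form, multiplying by \<open>l\<close> reverses the sign of the argument
    of \<open>c\<close>. This also covers \<open>c = 0\<close>, where both sides vanish.\<close>
  have "l * c = of_real (cmod c) * exp (- (\<i> * of_real (Arg2pi c)))"
    by (subst Arg2pi_eq[of c]) (simp add: l_def mult_ac flip: exp_add)
  also have "\<dots> = cnj (of_real (cmod c) * exp (\<i> * of_real (Arg2pi c)))"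
    by (simp add: exp_cnj)
  also have "\<dots> = cnj c"
    by (simp flip: Arg2pi_eq)
  finally have lc: "l * c = cnj c" .
  have rotation: "rotation_op l \<circ> conj_J = twisted_conj l"
    by (simp add: fun_eq_iff rotation_op_def conj_J_def twisted_conj_def)
  have J: "conj_J = twisted_conj 1"
    by (simp add: fun_eq_iff conj_J_def twisted_conj_def)
  have "C_symmetric \<alpha> (twisted_conj l) T"
    by (intro C_symmetric_twisted_conj adjoint_pair_T_twisted_conj l lc)
  moreover have "C_symmetric \<alpha> (twisted_conj 1) T" if "c = 0"
    by (intro C_symmetric_twisted_conj adjoint_pair_T_twisted_conj) (simp_all add: that)
  moreover have "normal_op \<alpha> T \<longleftrightarrow> b \<in> \<real> - {0} \<or> c = 0"
    using normal_if_real normal_if_zero normal_imp_real[OF _ _ _ l lc] assms(3,4) by blast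
  ultimately show ?thesis
    unfolding l_def[symmetric] rotation unfolding J by blast
qed

end
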